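(* Let $m\geq 1$ and $\mathfrak{a}_{1},\ldots,\mathfrak{a}_m\in GL_l(\mathbb{C})$ be such that $\mathfrak{Q}_m$ is invertible, with inverse $\mathfrak{R}_m$. Then $\mathfrak{P}_m:=(-1)^{m-1}\left((\mathfrak{R}_{m})_{m1}\right)^{-1}$ satisfies $$\mathfrak{P}_{m}=\mathfrak{p}_{m}(\mathfrak{a}_{1},\ldots,\mathfrak{a}_{m}),$$ where $(\mathfrak{R}_{m})_{m1}$ is the $l\times l$ block of $\mathfrak{R}_m$ in block position $(m,1)$.
   Context: $I$, $O$ are the $l\times l$ identity and zero matrices. The left matrix signed Chebyshev polynomials are defined by $\mathfrak{p}_{-1}=O$, $\mathfrak{p}_{0}=I$ and $$\mathfrak{p}_{m}(\mathfrak{a}_{1},\ldots,\mathfrak{a}_{m})=\mathfrak{a}_{m}\mathfrak{p}_{m-1}(\mathfrak{a}_{1},\ldots,\mathfrak{a}_{m-1})-\mathfrak{p}_{m-2}(\mathfrak{a}_{1},\ldots,\mathfrak{a}_{m-2}),\quad m\ge 1.$$ $\mathfrak{Q}_1=\mathfrak{a}_1$ and, for $m\ge 2$, $\mathfrak{Q}_m$ is the block tridiagonal $ml\times ml$ matrix, with $m\times m$ blocks of size $l\times l$, with diagonal blocks $\mathfrak{a}_{m},\mathfrak{a}_{m-1},\ldots,\mathfrak{a}_1$ (from top left to bottom right), all blocks immediately above and immediately below the diagonal equal to $I$, and all other blocks equal to $O$. *)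

theory Defs
  imports Complex_Main "Jordan_Normal_Form.Gauss_Jordan_Elimination"
begin

definition GL :: "nat \<Rightarrow> complex mat set" where
  "GL l = {A \<in> carrier_mat l l. invertible_mat A}"

text \<open>The index is shifted by one, so that the recursion can start at \<open>p\<^sub>-\<^sub>1 = O\<close>:
  the value at \<open>k\<close> is \<open>p\<close> with subscript \<open>k - 1\<close>.\<close>

fun left_cheb_shifted :: "nat \<Rightarrow> (nat \<Rightarrow> complex mat) \<Rightarrow> nat \<Rightarrow> complex mat" where
  "left_cheb_shifted l a 0 = 0\<^sub>m l l"
| "left_cheb_shifted l a (Suc 0) = 1\<^sub>m l"
| "left_cheb_shifted l a (Suc (Suc k)) =
     a (Suc k) * left_cheb_shifted l a (Suc k) - left_cheb_shifted l a k"

text \<open>The arguments \<open>a\<^sub>1, \<dots>, a\<^sub>m\<close> are given as a sequence, of which only the entries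
  with index \<open>1, \<dots>, m\<close> are used.\<close>

definition left_cheb :: "nat \<Rightarrow> (nat \<Rightarrow> complex mat) \<Rightarrow> nat \<Rightarrow> complex mat" where
  "left_cheb l a m = left_cheb_shifted l a (Suc m)"

lemma left_cheb_0: "left_cheb l a 0 = 1\<^sub>m l"
  by (simp add: left_cheb_def)

lemma left_cheb_1: "left_cheb l a 1 = a 1 * 1\<^sub>m l - 0\<^sub>m l l"
  by (simp add: left_cheb_def)

lemma left_cheb_rec:
  "left_cheb l a (Suc (Suc k)) = a (Suc (Suc k)) * left_cheb l a (Suc k) - left_cheb l a k"
  by (simp add: left_cheb_def)

text \<open>Block positions are numbered from 1, while the entries of a matrix are numbered from 0.\<close>

definition mat_of_blocks :: "nat \<Rightarrow> nat \<Rightarrow> (nat \<Rightarrow> nat \<Rightarrow> complex mat) \<Rightarrow> complex mat" where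
  "mat_of_blocks l m B =
     mat (m * l) (m * l) (\<lambda>(r, s). B (r div l + 1) (s div l + 1) $$ (r mod l, s mod l))"

definition mat_block :: "nat \<Rightarrow> complex mat \<Rightarrow> nat \<Rightarrow> nat \<Rightarrow> complex mat" where
  "mat_block l A i j = mat l l (\<lambda>(r, s). A $$ ((i - 1) * l + r, (j - 1) * l + s))"

lemma mat_block_mat_of_blocks:
  assumes "i \<in> {1..m}" and "j \<in> {1..m}" and B: "B i j \<in> carrier_mat l l"
  shows "mat_block l (mat_of_blocks l m B) i j = B i j"
proof -
  obtain i' j' where ij: "i = Suc i'" "j = Suc j'" "i' < m" "j' < m"
    using that[of "i - 1" "j - 1"] assms by auto
  have lt: "k * l + r < m * l" if "k < m" "r < l" for k r :: nat
  proof -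
    have "k * l + r < Suc k * l" using that(2) by simp
    also have "\<dots> \<le> m * l" using that(1) by (intro mult_le_mono1) simp
    finally show ?thesis .
  qed
  show ?thesis
  proof (rule eq_matI)
    fix r s assume "r < dim_row (B i j)" "s < dim_col (B i j)"
    then have "r < l" "s < l" using B by auto
    then show "mat_block l (mat_of_blocks l m B) i j $$ (r, s) = B i j $$ (r, s)"
      using ij lt[of i' r] lt[of j' s] by (simp add: mat_block_def mat_of_blocks_def)
  qed (use B in \<open>auto simp: mat_block_def\<close>)
qed

definition Q_mat :: "nat \<Rightarrow> (nat \<Rightarrow> complex mat) \<Rightarrow> nat \<Rightarrow> complex mat" where
  "Q_mat l a m = mat_of_blocks l m (\<lambda>i j.
     if i = j then a (m + 1 - i)
     else if j = i + 1 \<or> i = j + 1 then 1\<^sub>m l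
     else 0\<^sub>m l l)"

lemma Q_mat_1:
  assumes "a 1 \<in> carrier_mat l l"
  shows "Q_mat l a 1 = a 1"
proof (rule eq_matI)
  fix r s assume "r < dim_row (a 1)" "s < dim_col (a 1)"
  then have "r < l" "s < l" using assms by auto
  then show "Q_mat l a 1 $$ (r, s) = a 1 $$ (r, s)"
    by (simp add: Q_mat_def mat_of_blocks_def)
qed (use assms in \<open>auto simp: Q_mat_def mat_of_blocks_def\<close>)

text \<open>The inverse of the block is taken with the library function \<open>mat_inverse\<close>,
  which is \<open>None\<close> for a singular matrix. The value is therefore meaningful only if
  the block in position \<open>(m, 1)\<close> is invertible.\<close>

definition P_mat :: "nat \<Rightarrow> complex mat \<Rightarrow> nat \<Rightarrow> complex mat" where
  "P_mat l R m = (- 1) ^ (m - 1) \<cdot>\<^sub>m the (mat_inverse (mat_block l R m 1))"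

end

theory Submission
  imports Defs "Jordan_Normal_Form.Determinant"
begin

text \<open>
  Let \<open>V\<close> be the block column with blocks \<open>p\<^sub>m\<^sub>-\<^sub>1, - p\<^sub>m\<^sub>-\<^sub>2, \<dots>, (-1)\<^sup>m\<^sup>-\<^sup>1 p\<^sub>0\<close>. By the recursion,
  \<open>Q\<^sub>m V\<close> is the block column with \<open>p\<^sub>m\<close> on top and zero blocks below. Multiplying by \<open>R\<^sub>m\<close> from
  the left and reading off the last block gives \<open>(R\<^sub>m)\<^sub>m\<^sub>1 p\<^sub>m = (-1)\<^sup>m\<^sup>-\<^sup>1 I\<close>.
\<close>

text \<open>Blocks are numbered from 1, as in \<open>mat_of_blocks\<close>, so that the block column
  index of a matrix and the block index of a column agree in products.\<close>

definition block_col :: "nat \<Rightarrow> nat \<Rightarrow> (nat \<Rightarrow> complex mat) \<Rightarrow> complex mat" where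
  "block_col l m W = mat (m * l) l (\<lambda>(r, c). W (r div l + 1) $$ (r mod l, c))"

lemma block_col_carrier [simp]: "block_col l m W \<in> carrier_mat (m * l) l"
  by (simp add: block_col_def)

lemma mat_of_blocks_carrier [simp]: "mat_of_blocks l m B \<in> carrier_mat (m * l) (m * l)"
  by (simp add: mat_of_blocks_def)

lemma block_index_less:
  fixes k l m r :: nat
  assumes "k < m" and "r < l"
  shows "k * l + r < m * l"
proof -
  have "k * l + r < Suc k * l" using assms by simp
  also have "\<dots> \<le> m * l" using assms by (intro mult_le_mono1) simp
  finally show ?thesis .
qed

lemma block_col_index:
  assumes "k < m" and "r < l" and "c < l"
  shows "block_col l m W $$ (k * l + r, c) = W (k + 1) $$ (r, c)"
  using assms block_index_less[OF assms(1,2)] by (simp add: block_col_def)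

text \<open>Division by \<open>l\<close> writes each row index below \<open>m * l\<close> as
  \<open>k * l + r\<close> with \<open>k < m\<close> and \<open>r < l\<close>, so a comparison block
  by block covers all entries.\<close>

lemma block_col_eqI:
  assumes A: "A \<in> carrier_mat (m * l) l"
    and eq: "\<And>k r c. k < m \<Longrightarrow> r < l \<Longrightarrow> c < l \<Longrightarrow> A $$ (k * l + r, c) = W (k + 1) $$ (r, c)"
  shows "A = block_col l m W"
proof (rule eq_matI)
  fix r c assume "r < dim_row (block_col l m W)" "c < dim_col (block_col l m W)"
  then have rc: "r < m * l" "c < l" by (auto simp: block_col_def)
  then have l: "r mod l < l" by simp
  have "r div l < m" using rc by (simp add: less_mult_imp_div_less)
  from eq[OF this l rc(2)] show "A $$ (r, c) = block_col l m W $$ (r, c)"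
    using rc by (simp add: block_col_def)
qed (use A in \<open>auto simp: block_col_def\<close>)

text \<open>This makes block multiplication applicable to a matrix that is not built from blocks,
  namely to the given inverse \<open>R\<close>.\<close>

lemma mat_of_blocks_mat_block:
  assumes "A \<in> carrier_mat (m * l) (m * l)"
  shows "mat_of_blocks l m (mat_block l A) = A"
proof (rule eq_matI)
  fix r s assume "r < dim_row A" "s < dim_col A"
  then have rs: "r < m * l" "s < m * l" using assms by auto
  then have "0 < l" by (cases l) auto
  then show "mat_of_blocks l m (mat_block l A) $$ (r, s) = A $$ (r, s)"
    using rs by (simp add: mat_of_blocks_def mat_block_def)
qed (use assms in \<open>auto simp: mat_of_blocks_def\<close>)

text \<open>The scalar product over \<open>m * l\<close> indices splits into \<open>m\<close>
  consecutive groups of length \<open>l\<close>; each group is an entry of a product of two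
  blocks.\<close>

lemma mat_of_blocks_mult_block_col_index:
  assumes B: "\<And>j. j \<in> {1..m} \<Longrightarrow> B (k + 1) j \<in> carrier_mat l l"
    and W: "\<And>j. j \<in> {1..m} \<Longrightarrow> W j \<in> carrier_mat l l"
    and k: "k < m" and r: "r < l" and c: "c < l"
  shows "(mat_of_blocks l m B * block_col l m W) $$ (k * l + r, c)
    = (\<Sum>j\<in>{1..m}. (B (k + 1) j * W j) $$ (r, c))"
proof -
  let ?g = "\<lambda>s. mat_of_blocks l m B $$ (k * l + r, s) * block_col l m W $$ (s, c)"
  have kr: "k * l + r < m * l" by (rule block_index_less[OF k r])
  have "(mat_of_blocks l m B * block_col l m W) $$ (k * l + r, c) = sum ?g {..<m * l}"
    using kr c by (simp add: scalar_prod_def mat_of_blocks_def block_col_def atLeast0LessThan)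
  also have "\<dots> = (\<Sum>j<m. sum ?g {j * l..<j * l + l})"
    by (rule sum.nat_group[symmetric])
  also have "\<dots> = (\<Sum>j<m. (B (k + 1) (j + 1) * W (j + 1)) $$ (r, c))"
  proof (rule sum.cong[OF refl])
    fix j assume "j \<in> {..<m}"
    then have j: "j < m" by simp
    have "sum ?g {j * l..<j * l + l} = (\<Sum>t<l. ?g (j * l + t))"
      using sum.shift_bounds_nat_ivl[of ?g 0 "j * l" l]
      by (simp add: atLeast0LessThan add.commute)
    also have "\<dots> = (\<Sum>t<l. B (k + 1) (j + 1) $$ (r, t) * W (j + 1) $$ (t, c))"
      using kr r c j block_index_less[OF j]
      by (intro sum.cong) (auto simp: block_col_index mat_of_blocks_def)
    also have "\<dots> = (B (k + 1) (j + 1) * W (j + 1)) $$ (r, c)"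
      using B[of "j + 1"] W[of "j + 1"] j r c
      by (auto simp: scalar_prod_def atLeast0LessThan)
    finally show "sum ?g {j * l..<j * l + l} = (B (k + 1) (j + 1) * W (j + 1)) $$ (r, c)" .
  qed
  also have "\<dots> = (\<Sum>j\<in>{1..m}. (B (k + 1) j * W j) $$ (r, c))"
    by (rule sum.reindex_bij_witness[of _ "\<lambda>j. j - 1" "\<lambda>j. j + 1"]) auto
  finally show ?thesis .
qed

text \<open>Because of the index shift, the value at \<open>k\<close> involves only
  \<open>a 1\<close>, ..., \<open>a (k - 1)\<close>; this explains the bound
  \<open>Suc m\<close>.\<close>

lemma left_cheb_shifted_carrier:
  assumes "\<And>i. i \<in> {1..m} \<Longrightarrow> a i \<in> carrier_mat l l" and "k \<le> Suc m"
  shows "left_cheb_shifted l a k \<in> carrier_mat l l"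
  using assms(2)
proof (induction l a k rule: left_cheb_shifted.induct)
  case (3 l a k)
  then show ?case by auto
qed auto

text \<open>Up to the sign \<open>(- 1) ^ k\<close>, block row \<open>k + 1\<close> of the product
  is \<open>a (n + 1)\<close> times p_n, minus p_(n-1), minus p_(n+1), where
  \<open>n = m - (k + 1)\<close>. The recursion makes this vanish, except in the first row, where
  the last term is absent and p_m remains.\<close>

lemma Q_mat_mult_cheb_col:
  assumes a: "\<And>i. i \<in> {1..m} \<Longrightarrow> a i \<in> carrier_mat l l"
  shows "Q_mat l a m * block_col l m (\<lambda>j. (- 1) ^ (j - 1) \<cdot>\<^sub>m left_cheb_shifted l a (m + 1 - j))
    = block_col l m (\<lambda>i. if i = 1 then left_cheb l a m else 0\<^sub>m l l)"
    (is "_ * block_col l m ?V = block_col l m ?E")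
proof (rule block_col_eqI)
  show "Q_mat l a m * block_col l m ?V \<in> carrier_mat (m * l) l"
    unfolding Q_mat_def by (rule mult_carrier_mat[OF mat_of_blocks_carrier block_col_carrier])
next
  fix k r c assume k: "k < m" and r: "r < l" and c: "c < l"
  let ?s = "left_cheb_shifted l a"
  let ?B = "\<lambda>i j. if i = j then a (m + 1 - i)
     else if j = i + 1 \<or> i = j + 1 then 1\<^sub>m l else 0\<^sub>m l l"
  have s: "?s i \<in> carrier_mat l l" if "i \<le> Suc m" for i
    using left_cheb_shifted_carrier[OF a that] by auto
  have V: "?V j \<in> carrier_mat l l" if "j \<in> {1..m}" for j
    using s[of "m + 1 - j"] by simp
  have ak: "a (m - k) \<in> carrier_mat l l" using a[of "m - k"] k by simp
  have B: "?B (k + 1) j \<in> carrier_mat l l" for j using ak by auto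
  \<comment> \<open>The diagonal block of this row is \<open>a (Suc n)\<close>, so the recursion
    applies at \<open>Suc (Suc n)\<close> with no truncated subtraction left.\<close>
  define n where "n = m - (k + 1)"
  have n: "m - k = Suc n" using k by (simp add: n_def)
  have "(Q_mat l a m * block_col l m ?V) $$ (k * l + r, c)
      = (\<Sum>j\<in>{1..m}. (?B (k + 1) j * ?V j) $$ (r, c))"
    unfolding Q_mat_def
    by (rule mat_of_blocks_mult_block_col_index[of m ?B k l ?V r c, OF B V k r c])
  \<comment> \<open>Separate indicators handle the border rows uniformly: an index \<open>k\<close>
    or \<open>k + 2\<close> outside \<open>{1..m}\<close> simply contributes nothing to the
    sum.\<close>
  also have "\<dots> = (\<Sum>j\<in>{1..m}. (if j = k + 1 then (a (m - k) * ?V (k + 1)) $$ (r, c) else 0)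
      + (if j = k + 2 then ?V (k + 2) $$ (r, c) else 0)
      + (if j = k then ?V k $$ (r, c) else 0))"
  proof (rule sum.cong[OF refl])
    fix j assume "j \<in> {1..m}"
    then have "?V j \<in> carrier_mat l l" by (rule V)
    then show "(?B (k + 1) j * ?V j) $$ (r, c)
      = (if j = k + 1 then (a (m - k) * ?V (k + 1)) $$ (r, c) else 0)
        + (if j = k + 2 then ?V (k + 2) $$ (r, c) else 0)
        + (if j = k then ?V k $$ (r, c) else 0)"
      using r c by (auto simp: left_mult_zero_mat left_mult_one_mat)
  qed
  also have "\<dots> = (a (m - k) * ?V (k + 1)) $$ (r, c)
      + (if k + 2 \<le> m then ?V (k + 2) $$ (r, c) else 0)
      + (if 1 \<le> k then ?V k $$ (r, c) else 0)"
    using k by (simp add: sum.distrib)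
  also have "a (m - k) * ?V (k + 1) = (- 1) ^ k \<cdot>\<^sub>m (a (Suc n) * ?s (Suc n))"
  proof -
    have "?s (Suc n) \<in> carrier_mat l l" using s[of "Suc n"] by (simp add: n_def)
    from mult_smult_distrib[OF ak this] show ?thesis using n by (simp add: Suc_diff_le)
  qed
  \<comment> \<open>In the last block row there is no right neighbour. There \<open>n = 0\<close>,
    and the formula still holds because the shifted value at 0 is p_(-1) = O.\<close>
  also have "(if k + 2 \<le> m then ?V (k + 2) $$ (r, c) else 0) = - ((- 1) ^ k * ?s n $$ (r, c))"
  proof (cases "k + 2 \<le> m")
    case True
    then have "m + 1 - (k + 2) = n" by (simp add: n_def)
    moreover have "?s n \<in> carrier_mat l l" by (rule s) (simp add: n_def)
    ultimately show ?thesis using True r c by auto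
  next
    case False
    then have "n = 0" by (simp add: n_def)
    then show ?thesis using False r c by simp
  qed
  \<comment> \<open>The case \<open>k = 0\<close> has to stay apart: the first block row has no left
    neighbour, and the term p_m that would cancel is missing.\<close>
  also have "(if 1 \<le> k then ?V k $$ (r, c) else 0)
      = (if k = 0 then 0 else - ((- 1) ^ k * ?s (Suc (Suc n)) $$ (r, c)))"
  proof (cases k)
    case (Suc k')
    then have "m + 1 - k = Suc (Suc n)" using n k by simp
    moreover have "?s (Suc (Suc n)) \<in> carrier_mat l l" by (rule s) (use n in simp)
    ultimately show ?thesis using Suc r c by (auto simp del: left_cheb_shifted.simps)
  qed simp
  also have "((- 1) ^ k \<cdot>\<^sub>m (a (Suc n) * ?s (Suc n))) $$ (r, c) + - ((- 1) ^ k * ?s n $$ (r, c))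
      + (if k = 0 then 0 else - ((- 1) ^ k * ?s (Suc (Suc n)) $$ (r, c)))
      = ?E (k + 1) $$ (r, c)"
  proof -
    have sc: "?s (Suc n) \<in> carrier_mat l l" "?s n \<in> carrier_mat l l"
      using s[of "Suc n"] s[of n] k by (auto simp: n_def)
    have an: "a (Suc n) \<in> carrier_mat l l" using ak n by simp
    have "?s (Suc (Suc n)) $$ (r, c) = (a (Suc n) * ?s (Suc n)) $$ (r, c) - ?s n $$ (r, c)"
      using sc an r c by (simp del: index_mult_mat(1))
    moreover have "((- 1) ^ k \<cdot>\<^sub>m (a (Suc n) * ?s (Suc n))) $$ (r, c)
        = (- 1) ^ k * (a (Suc n) * ?s (Suc n)) $$ (r, c)"
      using sc an r c by (simp del: index_mult_mat(1))
    moreover have "left_cheb l a m = ?s (Suc (Suc n))" if "k = 0"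
      using n that by (simp add: left_cheb_def)
    ultimately show ?thesis
      using r c by (simp add: right_diff_distrib del: left_cheb_shifted.simps index_mult_mat(1))
  qed
  finally show "(Q_mat l a m * block_col l m ?V) $$ (k * l + r, c) = ?E (k + 1) $$ (r, c)" .
qed

text \<open>Invertibility of the block is a consequence here: up to sign, p_m is exhibited as a
  right inverse of it.\<close>

lemma mat_block_mult_left_cheb:
  assumes m: "m \<ge> 1"
    and a: "\<And>i. i \<in> {1..m} \<Longrightarrow> a i \<in> carrier_mat l l"
    and R: "R \<in> carrier_mat (m * l) (m * l)"
    and RQ: "R * Q_mat l a m = 1\<^sub>m (m * l)"
  shows "mat_block l R m 1 * left_cheb l a m = (- 1) ^ (m - 1) \<cdot>\<^sub>m 1\<^sub>m l"
proof (rule eq_matI)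
  let ?V = "\<lambda>j. (- 1) ^ (j - 1) \<cdot>\<^sub>m left_cheb_shifted l a (m + 1 - j)"
  let ?E = "\<lambda>i. if i = 1 then left_cheb l a m else 0\<^sub>m l l"
  have p: "left_cheb l a m \<in> carrier_mat l l"
    unfolding left_cheb_def by (rule left_cheb_shifted_carrier[OF a]) auto
  have Q: "Q_mat l a m \<in> carrier_mat (m * l) (m * l)" by (simp add: Q_mat_def)
  have RB: "mat_block l R i j \<in> carrier_mat l l" for i j by (simp add: mat_block_def)
  have "block_col l m ?V = (R * Q_mat l a m) * block_col l m ?V"
    by (simp add: RQ left_mult_one_mat[OF block_col_carrier])
  also have "\<dots> = R * (Q_mat l a m * block_col l m ?V)"
    by (rule assoc_mult_mat[OF R Q block_col_carrier])
  also have "\<dots> = mat_of_blocks l m (mat_block l R) * block_col l m ?E"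
    using Q_mat_mult_cheb_col[OF a] by (simp add: mat_of_blocks_mat_block[OF R])
  finally have col: "block_col l m ?V = mat_of_blocks l m (mat_block l R) * block_col l m ?E" .
  fix r c
  assume "r < dim_row ((- 1) ^ (m - 1) \<cdot>\<^sub>m 1\<^sub>m l :: complex mat)"
    "c < dim_col ((- 1) ^ (m - 1) \<cdot>\<^sub>m 1\<^sub>m l :: complex mat)"
  then have r: "r < l" and c: "c < l" by auto
  have k: "m - 1 < m" using m by simp
  have E: "?E j \<in> carrier_mat l l" for j using p by simp
  \<comment> \<open>For \<open>j = m\<close> the shifted index \<open>m + 1 - j\<close> is 1, so the
    last block of the column is the sign times p_0 = I.\<close>
  have "((- 1) ^ (m - 1) \<cdot>\<^sub>m 1\<^sub>m l) $$ (r, c) = block_col l m ?V $$ ((m - 1) * l + r, c)"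
    using m block_col_index[OF k r c, of ?V] by simp
  also have "\<dots> = (\<Sum>j\<in>{1..m}. (mat_block l R m j * ?E j) $$ (r, c))"
    unfolding col using m
    by (subst mat_of_blocks_mult_block_col_index[of m "mat_block l R" "m - 1" l ?E r c, OF RB E k r c]) simp
  also have "\<dots> = (\<Sum>j\<in>{1..m}. if j = 1 then (mat_block l R m 1 * left_cheb l a m) $$ (r, c) else 0)"
    using r c by (intro sum.cong) (auto simp: right_mult_zero_mat[OF RB])
  also have "\<dots> = (mat_block l R m 1 * left_cheb l a m) $$ (r, c)"
    using m by simp
  finally show "(mat_block l R m 1 * left_cheb l a m) $$ (r, c)
      = ((- 1) ^ (m - 1) \<cdot>\<^sub>m 1\<^sub>m l) $$ (r, c)" ..
next
  have "left_cheb l a m \<in> carrier_mat l l"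
    unfolding left_cheb_def by (rule left_cheb_shifted_carrier[OF a]) auto
  then show "dim_row (mat_block l R m 1 * left_cheb l a m)
      = dim_row ((- 1) ^ (m - 1) \<cdot>\<^sub>m 1\<^sub>m l :: complex mat)"
    and "dim_col (mat_block l R m 1 * left_cheb l a m)
      = dim_col ((- 1) ^ (m - 1) \<cdot>\<^sub>m 1\<^sub>m l :: complex mat)"
    by (auto simp: mat_block_def)
qed

lemma smult_mat_assoc:
  fixes x y :: "'a :: semigroup_mult"
  shows "x \<cdot>\<^sub>m (y \<cdot>\<^sub>m A) = (x * y) \<cdot>\<^sub>m A"
  by (rule eq_matI) (auto simp: mult.assoc)

text \<open>For square matrices over a field a right inverse is two-sided. Hence \<open>A\<close> is
  a unit of the matrix ring, which excludes \<open>None\<close>, and uniqueness of inverses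
  identifies the result as \<open>B\<close>.\<close>

lemma mat_inverse_eq_Some:
  fixes A :: "'a :: field mat"
  assumes A: "A \<in> carrier_mat n n" and B: "B \<in> carrier_mat n n"
    and AB: "A * B = 1\<^sub>m n"
  shows "mat_inverse A = Some B"
proof -
  have BA: "B * A = 1\<^sub>m n" by (rule mat_mult_left_right_inverse[OF A B AB])
  show ?thesis
  proof (cases "mat_inverse A")
    case None
    have "A \<in> Units (ring_mat TYPE('a) n ())"
      using A B AB BA by (auto simp: Units_def ring_mat_def)
    then show ?thesis using mat_inverse(1)[OF A None, of "()"] by simp
  next
    case (Some C)
    then have C: "C * A = 1\<^sub>m n" "C \<in> carrier_mat n n"
      using mat_inverse(2)[OF A Some] by auto
    have "C = C * (A * B)" using AB C by simp
    also have "\<dots> = (C * A) * B" using assoc_mult_mat[OF C(2) A B] by simp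
    also have "\<dots> = B" using C B by simp
    finally show ?thesis using Some by simp
  qed
qed

theorem proposition46:
  fixes l m :: nat and a :: "nat \<Rightarrow> complex mat" and R :: "complex mat"
  assumes "m \<ge> 1"
    and "\<And>i. i \<in> {1..m} \<Longrightarrow> a i \<in> GL l"
    and "R \<in> carrier_mat (m * l) (m * l)"
    and "inverts_mat (Q_mat l a m) R" and "inverts_mat R (Q_mat l a m)"
  shows "invertible_mat (mat_block l R m 1) \<and> P_mat l R m = left_cheb l a m"
proof -
  let ?X = "mat_block l R m 1" and ?p = "left_cheb l a m" and ?e = "(- 1) ^ (m - 1) :: complex"
  have a: "a i \<in> carrier_mat l l" if "i \<in> {1..m}" for i
    using assms(2)[OF that] by (simp add: GL_def)
  have p: "?p \<in> carrier_mat l l"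
    unfolding left_cheb_def by (rule left_cheb_shifted_carrier[OF a]) auto
  have X: "?X \<in> carrier_mat l l" by (simp add: mat_block_def)
  \<comment> \<open>The sign is its own inverse. This is used twice:
    \<open>?e \<cdot>\<^sub>m ?p\<close> becomes the inverse of the block, and the sign in
    \<open>P_mat\<close> then cancels the one in that inverse.\<close>
  have ee: "?e * ?e = 1" by (simp add: power_mult_distrib[symmetric])
  have "R * Q_mat l a m = 1\<^sub>m (m * l)"
    using assms(3,5) by (simp add: inverts_mat_def)
  then have "?X * ?p = ?e \<cdot>\<^sub>m 1\<^sub>m l"
    using mat_block_mult_left_cheb[of m a l R] assms(1,3) a by blast
  then have "?X * (?e \<cdot>\<^sub>m ?p) = (?e * ?e) \<cdot>\<^sub>m 1\<^sub>m l"
    by (simp only: mult_smult_distrib[OF X p] smult_mat_assoc)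
  also have "\<dots> = 1\<^sub>m l"
    unfolding ee by (rule eq_matI) auto
  finally have XY: "?X * (?e \<cdot>\<^sub>m ?p) = 1\<^sub>m l" .
  have Y: "?e \<cdot>\<^sub>m ?p \<in> carrier_mat l l" using p by simp
  have "P_mat l R m = (?e * ?e) \<cdot>\<^sub>m ?p"
    by (simp only: P_mat_def mat_inverse_eq_Some[OF X Y XY] option.sel smult_mat_assoc)
  also have "\<dots> = ?p"
    unfolding ee by (rule eq_matI) auto
  finally have "P_mat l R m = ?p" .
  moreover have "invertible_mat ?X"
    using X Y XY mat_mult_left_right_inverse[OF X Y XY]
    by (auto simp: invertible_mat_def inverts_mat_def intro!: exI[of _ "?e \<cdot>\<^sub>m ?p"])
  ultimately show ?thesis by simp
qed

end
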